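(* Let $\mathcal C_\Lambda$ be a class of residual localized split packages with conservative admissible gauge class $\Gamma=\Gamma^{\mathrm{int}}_{\Lambda,\mathrm{adm}}$, and let $D\in\mathcal C_\Lambda$. Assume: (a) (same-gauge baseline near-minimizer) there is $\zeta_0=\zeta_0(D)\in\Gamma$ with $\|D-\zeta_0\|_{\mathrm{loc},\mathrm{int},0}\le\operatorname{dist}_{\mathrm{loc},\mathrm{int},0}(D,\Gamma)+\delta_0$, and this same $\zeta_0$ is used in (b) and (c); (b) (baseline coordinate visibility) there are $C_{\mathrm{vis}}<\infty$ and $\Delta_{\mathrm{vis}}\ge0$ with $$\|u_{D-\zeta_0}\|_{L^3(Q_1)}+\|E^{\mathrm{cl}}_{F,D-\zeta_0}\|_{X_{\mathrm{src}}}+\|p_{\mathrm{harm},D-\zeta_0}\|_{Y_{\mathrm{harm}}}\le C_{\mathrm{vis}}\operatorname{dist}_{\mathrm{loc},\mathrm{int},0}(D,\Gamma)+\Delta_{\mathrm{vis}};$$ (c) (finite amplitude) there is $M_U<\infty$ with $\|u_{D-\zeta_0}\|_{L^3(Q_1)}\le M_U$; (d) (tail-compatibility) $\mathcal C_\Lambda$ is a tail-compatible finite-window class: $\mathcal C_\Lambda\subset X_\Lambda$, where $X_\Lambda$ is a finite-dimensional normed package space with norm $\|\cdot\|_{\mathrm{loc},\mathrm{int},\mathrm{tail}}$ and $\Gamma\subset X_\Lambda$ is a gauge subspace, and there are constants $C^{\mathrm{tail}}_{\mathrm{proj}},C^{\mathrm{tail}}_{\mathrm{harm}}<\infty$ and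 errors $\Delta_{\mathrm{proj},N},\Delta^{(3/2)}_{\mathrm{harm},M}\ge0$ such that for every $D'\in\mathcal C_\Lambda$ and every $\zeta\in\Gamma$, $$T_{\mathrm{proj}}(D';\zeta)\le C^{\mathrm{tail}}_{\mathrm{proj}}\|D'-\zeta\|_{\mathrm{loc},\mathrm{int},\mathrm{tail}}+\Delta_{\mathrm{proj},N},\qquad T_{\mathrm{harm}}(D';\zeta)\le C^{\mathrm{tail}}_{\mathrm{harm}}\|D'-\zeta\|_{\mathrm{loc},\mathrm{int},\mathrm{tail}}+\Delta^{(3/2)}_{\mathrm{harm},M}.$$ Then $$\operatorname{dist}^{\sharp,\mathrm{tail}}_{\mathrm{loc},\mathrm{int},\mathrm{tail}}(D,\Gamma)\le C_{\mathrm{tail}}\bigl[(1+C_{\mathrm{tail}/0})\operatorname{dist}_{\mathrm{loc},\mathrm{int},0}(D,\Gamma)+\delta_0+\Delta_{\mathrm{tail}/0}\bigr]+\alpha_{\mathrm{proj}}\Delta_{\mathrm{proj},N}+\alpha_{\mathrm{harm}}\Delta^{(3/2)}_{\mathrm{harm},M},$$ where $C_{\mathrm{tail}}=1+\alpha_{\mathrm{proj}}C^{\mathrm{tail}}_{\mathrm{proj}}+\alpha_{\mathrm{harm}}C^{\mathrm{tail}}_{\mathrm{harm}}$, and one may take $$C_{\mathrm{tail}/0}=C_{\mathrm{vis}}\max\{C_{\mathrm{CZ}}M_U,C_{\mathrm{CZ}},1\},\qquad \Delta_{\mathrm{tail}/0}=\max\{C_{\mathrm{CZ}}M_U,C_{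\mathrm{CZ}},1\}\,\Delta_{\mathrm{vis}}.$$
   Context: Geometry: $I=(-1,0)$, $Q_1=B_1\times I$, $B_{1/2}\subset B_{3/4}\subset B_1\subset\mathbb R^3$, $\eta\in C_c^\infty(B_1)$ with $0\le\eta\le1$ and $\eta\equiv1$ on $B_{3/4}$. $X_{\mathrm{src}}=L^{3/2}(I;L^{3/2}(B_1))^{3\times3}$, $Y_{\mathrm{prs}}=L^{3/2}(I;L^{3/2}(B_{1/2}))$, $Y_{\mathrm{harm}}=L^{3/2}(I;L^{3/2}(B_{3/4}))$ (the pressure-natural harmonic space). $R_i$ are the Riesz transforms on $\mathbb R^3$, applied after zero extension outside $B_1$; repeated indices are summed. A residual localized split package is an object $D=(u_D,p_{\mathrm{act},D},p_{\mathrm{harm},D},F^{\mathrm{cl}}_D,E^{\mathrm{cl}}_{F,D},\Pi_D,\Phi_D,T_D,s_D)$ with $u_D\in L^3(Q_1)^3$, $E^{\mathrm{cl}}_{F,D}\in X_{\mathrm{src}}$, $p_{\mathrm{harm},D}\in Y_{\mathrm{harm}}$ spatially harmonic in $B_{3/4}$ for a.e. time, and $F^{\mathrm{cl}}_{D,ij}=\eta u_{D,i}u_{D,j}+E^{\mathrm{cl}}_{F,D,ij}$; $p_{\mathrm{act},D}$ is the active pressure coordinate and $\Pi_D,\Phi_D,T_D,s_D$ are auxiliary finite-window flux, energy or trace, selected-trace and slack data. Conservative admissible gauge class: $\Gamma=\{0\}\times G_E\times G_h\times G_{\mathrm{aux}}$ with $G_E\subset X_{\mathrm{src}}$, $G_h\subset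 Y_{\mathrm{harm}}$ finite-dimensional subspaces (elements of $G_h$ harmonic in $B_{3/4}$ for a.e. time) and $G_{\mathrm{aux}}$ a finite-dimensional auxiliary gauge space for the remaining coordinates. For $\zeta=(0,\zeta_E,\zeta_h,\dots)\in\Gamma$ the shifted package $D-\zeta$ has $u_{D-\zeta}=u_D$, $E^{\mathrm{cl}}_{F,D-\zeta}=E^{\mathrm{cl}}_{F,D}-\zeta_E$, $p_{\mathrm{harm},D-\zeta}=p_{\mathrm{harm},D}-\zeta_h$, $F^{\mathrm{cl}}_{D-\zeta,ij}=\eta u_{D,i}u_{D,j}+E^{\mathrm{cl}}_{F,D-\zeta,ij}$. $\|\cdot\|_{\mathrm{loc},\mathrm{int},0}$ is a given baseline intrinsic norm of packages, and $$\|D\|_{\mathrm{loc},\mathrm{int},\mathrm{tail}}=\|D\|_{\mathrm{loc},\mathrm{int},0}+\|R_iR_j(F^{\mathrm{cl}}_{D,ij})\|_{Y_{\mathrm{prs}}}+\|p_{\mathrm{harm},D}\|_{Y_{\mathrm{harm}}}.$$ $\operatorname{dist}_{\mathrm{loc},\mathrm{int},0}(D,\Gamma)=\inf_{\zeta\in\Gamma}\|D-\zeta\|_{\mathrm{loc},\mathrm{int},0}$. Given nonnegative tail functionals $T_{\mathrm{proj}}(D;\zeta)$, $T_{\mathrm{harm}}(D;\zeta)$ and weights $\alpha_{\mathrm{proj}},\alpha_{\mathrm{harm}}>0$, $$\operatorname{dist}^{\sharp,\mathrm{tail}}_{\mathrm{loc},\mathrm{int},\mathrm{tail}}(D,\Gamma)=\inf_{\zeta\in\Gamma}\bigl(\|D-\zeta\|_{\mathrm{loc},\mathrm{int},\mathrm{tail}}+\alpha_{\mathrm{proj}}T_{\mathrm{proj}}(D;\zeta)+\alpha_{\mathrm{harm}}T_{\mathrm{harm}}(D;\zeta)\bigr).$$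 $C_{\mathrm{CZ}}$ is a fixed Calderón–Zygmund constant such that for all shifted packages $\|R_iR_j(F^{\mathrm{cl}}_{D-\zeta,ij})\|_{Y_{\mathrm{prs}}}\le C_{\mathrm{CZ}}(\|u_{D-\zeta}\|_{L^3(Q_1)}^2+\|E^{\mathrm{cl}}_{F,D-\zeta}\|_{X_{\mathrm{src}}})$. *)

theory Defs
  imports "HOL-Analysis.Analysis"
begin

section \<open>Lebesgue norms of functions\<close>

definition lp_norm :: "real \<Rightarrow> 'a::euclidean_space set \<Rightarrow> ('a \<Rightarrow> 'b::euclidean_space) \<Rightarrow> real" where
  "lp_norm p S f = (LINT x:S|lebesgue. norm (f x) powr p) powr (1 / p)"

definition lp_mem :: "real \<Rightarrow> 'a::euclidean_space set \<Rightarrow> ('a \<Rightarrow> 'b::euclidean_space) \<Rightarrow> bool" where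
  "lp_mem p S f \<longleftrightarrow>
     f \<in> borel_measurable lebesgue \<and>
     (AE x in lebesgue. x \<notin> S \<longrightarrow> f x = 0) \<and>
     set_integrable lebesgue S (\<lambda>x. norm (f x) powr p)"

text \<open>The mixed norm of \<open>L\<^sup>q(T; L\<^sup>p(B))\<close>. The norm of an infinite integral is junk, so these norms are
  meaningful only together with membership.\<close>

definition lq_lp_norm ::
  "real \<Rightarrow> real \<Rightarrow> real set \<Rightarrow> (real^3) set \<Rightarrow> (real \<times> (real^3) \<Rightarrow> 'b::euclidean_space) \<Rightarrow> real" where
  "lq_lp_norm q p T B f = lp_norm q T (\<lambda>t. lp_norm p B (\<lambda>x. f (t, x)))"

definition lq_lp_mem ::
  "real \<Rightarrow> real \<Rightarrow> real set \<Rightarrow> (real^3) set \<Rightarrow> (real \<times> (real^3) \<Rightarrow> 'b::euclidean_space) \<Rightarrow> bool" where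
  "lq_lp_mem q p T B f \<longleftrightarrow>
     f \<in> borel_measurable lebesgue \<and>
     (AE z in lebesgue. z \<notin> T \<times> B \<longrightarrow> f z = 0) \<and>
     (AE t in lebesgue. t \<in> T \<longrightarrow> set_integrable lebesgue B (\<lambda>x. norm (f (t, x)) powr p)) \<and>
     set_integrable lebesgue T (\<lambda>t. lp_norm p B (\<lambda>x. f (t, x)) powr q)"


section \<open>Smooth and harmonic functions on open subsets of space\<close>

definition partial :: "3 \<Rightarrow> (real^3 \<Rightarrow> real) \<Rightarrow> real^3 \<Rightarrow> real" where
  "partial i f x = frechet_derivative f (at x) (axis i 1)"

primrec Ck_on :: "nat \<Rightarrow> (real^3) set \<Rightarrow> (real^3 \<Rightarrow> real) \<Rightarrow> bool" where
  "Ck_on 0 S f \<longleftrightarrow> continuous_on S f"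
| "Ck_on (Suc k) S f \<longleftrightarrow> (\<forall>x\<in>S. f differentiable (at x)) \<and> (\<forall>i. Ck_on k S (partial i f))"

definition laplacian :: "(real^3 \<Rightarrow> real) \<Rightarrow> real^3 \<Rightarrow> real" where
  "laplacian f x = (\<Sum>i\<in>UNIV. partial i (partial i f) x)"

definition harmonic_on :: "(real^3) set \<Rightarrow> (real^3 \<Rightarrow> real) \<Rightarrow> bool" where
  "harmonic_on S h \<longleftrightarrow> Ck_on 2 S h \<and> (\<forall>x\<in>S. laplacian h x = 0)"

definition cutoff :: "(real^3 \<Rightarrow> real) \<Rightarrow> bool" where
  "cutoff \<eta> \<longleftrightarrow>
     (\<forall>k. Ck_on k UNIV \<eta>) \<and>
     compact (closure {x. \<eta> x \<noteq> 0}) \<and> closure {x. \<eta> x \<noteq> 0} \<subseteq> ball 0 1 \<and>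
     (\<forall>x. 0 \<le> \<eta> x \<and> \<eta> x \<le> 1) \<and>
     (\<forall>x\<in>ball 0 (3/4). \<eta> x = 1)"


section \<open>Riesz transforms\<close>

text \<open>The principal value of the kernel $c_3\, z_j / |z|^4$ with
  $c_3 = \Gamma(2) / \pi^2 = 1 / \pi^2$.\<close>

definition riesz :: "3 \<Rightarrow> (real^3 \<Rightarrow> real) \<Rightarrow> real^3 \<Rightarrow> real" where
  "riesz j f x =
     Lim (at_right 0) (\<lambda>\<epsilon>. 1 / pi\<^sup>2 *
       (LINT y:{y. \<epsilon> \<le> norm (x - y)}|lebesgue. (x - y) $ j / norm (x - y) ^ 4 * f y))"

definition riesz_riesz :: "(real \<times> (real^3) \<Rightarrow> real^3^3) \<Rightarrow> real \<times> (real^3) \<Rightarrow> real" where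
  "riesz_riesz F = (\<lambda>(t, x). \<Sum>i\<in>UNIV. \<Sum>j\<in>UNIV.
     riesz i (riesz j (\<lambda>y. if y \<in> ball 0 1 then F (t, y) $ i $ j else 0)) x)"


section \<open>Almost-everywhere classes\<close>

lemma borel_measurable_lebesgue_cong_AE:
  fixes f g :: "'a::euclidean_space \<Rightarrow> 'b::topological_space"
  assumes "AE x in lebesgue. f x = g x"
  shows "f \<in> borel_measurable lebesgue \<longleftrightarrow> g \<in> borel_measurable lebesgue"
proof -
  have *: "g \<in> borel_measurable lebesgue"
    if f: "f \<in> borel_measurable lebesgue" and eq: "AE x in lebesgue. f x = g x"
    for f g :: "'a \<Rightarrow> 'b"
  proof (rule measurableI)
    fix A :: "'b set" assume A: "A \<in> sets borel"
    have "f -` A \<inter> space lebesgue \<in> sets lebesgue"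
      using f A by (rule measurable_sets)
    moreover have "AE x in lebesgue. (x \<in> f -` A \<inter> space lebesgue) = (x \<in> g -` A \<inter> space lebesgue)"
      using eq by (rule eventually_mono) auto
    ultimately show "g -` A \<inter> space lebesgue \<in> sets lebesgue"
      using completion.in_sets_AE by blast
  qed auto
  have "AE x in lebesgue. g x = f x"
    using assms by (rule eventually_mono) auto
  then show ?thesis
    using * assms by blast
qed

lemma integrable_lebesgue_cong_AE:
  fixes f g :: "'a::euclidean_space \<Rightarrow> 'b::euclidean_space"
  assumes "AE x in lebesgue. f x = g x"
  shows "integrable lebesgue f \<longleftrightarrow> integrable lebesgue g"
proof (cases "f \<in> borel_measurable lebesgue")
  case True
  then show ?thesis
    using assms borel_measurable_lebesgue_cong_AE[OF assms] by (intro integrable_cong_AE) auto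
next
  case False
  then show ?thesis
    using borel_measurable_lebesgue_cong_AE[OF assms] borel_measurable_integrable by blast
qed

lemma integral_lebesgue_cong_AE:
  fixes f g :: "'a::euclidean_space \<Rightarrow> 'b::euclidean_space"
  assumes "AE x in lebesgue. f x = g x"
  shows "integral\<^sup>L lebesgue f = integral\<^sup>L lebesgue g"
proof (cases "integrable lebesgue f")
  case True
  then show ?thesis
    using assms integrable_lebesgue_cong_AE[OF assms]
    by (intro integral_cong_AE) (auto intro: borel_measurable_integrable)
next
  case False
  then show ?thesis
    using integrable_lebesgue_cong_AE[OF assms] by (simp add: not_integrable_integral_eq)
qed

lemma AE_lebesgue_slice:
  fixes P :: "'a::euclidean_space \<times> 'b::euclidean_space \<Rightarrow> bool"
  assumes "AE z in lebesgue. P z"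
  shows "AE t in lebesgue. AE x in lebesgue. P (t, x)"
proof -
  have "AE z in lborel \<Otimes>\<^sub>M lborel. P z"
    unfolding lborel_prod using assms by (simp only: AE_completion_iff)
  from lborel_pair.AE_pair[OF this] show ?thesis
    by (simp add: AE_completion_iff)
qed

lemma AE_lebesgue_cylinder:
  fixes P :: "'a::euclidean_space \<Rightarrow> bool"
  assumes "AE t in lebesgue. P t"
  shows "AE z in (lebesgue :: ('a \<times> 'b::euclidean_space) measure). P (fst z)"
proof -
  have "AE t in lborel. P t"
    using assms by (simp add: AE_completion_iff)
  then obtain N where N: "N \<in> null_sets lborel" "{t. \<not> P t} \<subseteq> N"
    by (auto simp: eventually_ae_filter)
  have "N \<times> (UNIV :: 'b set) \<in> null_sets (lborel \<Otimes>\<^sub>M lborel)"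
    using N(1) by (auto simp: null_sets_def lborel.emeasure_pair_measure_Times)
  then have "N \<times> (UNIV :: 'b set) \<in> null_sets lborel"
    by (simp add: lborel_prod)
  then have "AE z in (lborel :: ('a \<times> 'b) measure). P (fst z)"
    by (rule AE_I') (use N(2) in auto)
  then show ?thesis
    by (simp add: AE_completion_iff)
qed

lemma lp_cong_AE:
  fixes f g :: "'a::euclidean_space \<Rightarrow> 'b::euclidean_space"
  assumes "AE x in lebesgue. f x = g x"
  shows set_integrable_powr_cong_AE:
      "set_integrable lebesgue S (\<lambda>x. norm (f x) powr p) \<longleftrightarrow>
       set_integrable lebesgue S (\<lambda>x. norm (g x) powr p)"
    and lp_norm_cong_AE: "lp_norm p S f = lp_norm p S g"
proof -
  have *: "AE x in lebesgue. indicat_real S x *\<^sub>R norm (f x) powr p = indicat_real S x *\<^sub>R norm (g x) powr p"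
    using assms by (rule eventually_mono) auto
  show "set_integrable lebesgue S (\<lambda>x. norm (f x) powr p) \<longleftrightarrow>
       set_integrable lebesgue S (\<lambda>x. norm (g x) powr p)"
    unfolding set_integrable_def by (rule integrable_lebesgue_cong_AE[OF *])
  show "lp_norm p S f = lp_norm p S g"
    unfolding lp_norm_def set_lebesgue_integral_def
    by (simp only: integral_lebesgue_cong_AE[OF *])
qed

lemma AE_imp_cong:
  assumes "AE x in M. P x = Q x"
  shows "(AE x in M. P x) = (AE x in M. Q x)"
  using eventually_subst[OF assms] .

lemma lp_mem_cong_AE:
  fixes f g :: "'a::euclidean_space \<Rightarrow> 'b::euclidean_space"
  assumes "AE x in lebesgue. f x = g x"
  shows "lp_mem p S f = lp_mem p S g"
proof -
  have "(AE x in lebesgue. x \<notin> S \<longrightarrow> f x = 0) = (AE x in lebesgue. x \<notin> S \<longrightarrow> g x = 0)"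
    by (rule AE_imp_cong, use assms in \<open>rule eventually_mono\<close>) auto
  then show ?thesis
    by (simp add: lp_mem_def borel_measurable_lebesgue_cong_AE[OF assms]
        set_integrable_powr_cong_AE[OF assms])
qed

lemma slice_lp_norm_cong_AE:
  assumes "AE z in lebesgue. f z = g z"
  shows "AE t in lebesgue. lp_norm p B (\<lambda>x. f (t, x)) = lp_norm p B (\<lambda>x. g (t, x))"
  using AE_lebesgue_slice[OF assms] by (rule eventually_mono) (rule lp_norm_cong_AE)

lemma lq_lp_norm_cong_AE:
  assumes "AE z in lebesgue. f z = g z"
  shows "lq_lp_norm q p T B f = lq_lp_norm q p T B g"
  unfolding lq_lp_norm_def by (rule lp_norm_cong_AE[OF slice_lp_norm_cong_AE[OF assms]])

lemma lp_norm_nonneg: "0 \<le> lp_norm p S f"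
  by (simp add: lp_norm_def)

lemma lq_lp_mem_cong_AE:
  assumes "AE z in lebesgue. f z = g z"
  shows "lq_lp_mem q p T B f = lq_lp_mem q p T B g"
proof -
  have 1: "(AE z in lebesgue. z \<notin> T \<times> B \<longrightarrow> f z = 0) = (AE z in lebesgue. z \<notin> T \<times> B \<longrightarrow> g z = 0)"
    by (rule AE_imp_cong, use assms in \<open>rule eventually_mono\<close>) auto
  have 2: "(AE t in lebesgue. t \<in> T \<longrightarrow> set_integrable lebesgue B (\<lambda>x. norm (f (t, x)) powr p)) =
        (AE t in lebesgue. t \<in> T \<longrightarrow> set_integrable lebesgue B (\<lambda>x. norm (g (t, x)) powr p))"
  proof (rule AE_imp_cong, use AE_lebesgue_slice[OF assms] in \<open>rule eventually_mono\<close>)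
    fix t assume "AE x in lebesgue. f (t, x) = g (t, x)"
    from set_integrable_powr_cong_AE[OF this]
    show "(t \<in> T \<longrightarrow> set_integrable lebesgue B (\<lambda>x. norm (f (t, x)) powr p)) =
        (t \<in> T \<longrightarrow> set_integrable lebesgue B (\<lambda>x. norm (g (t, x)) powr p))"
      by simp
  qed
  have 3: "set_integrable lebesgue T (\<lambda>t. lp_norm p B (\<lambda>x. f (t, x)) powr q) =
        set_integrable lebesgue T (\<lambda>t. lp_norm p B (\<lambda>x. g (t, x)) powr q)"
    using set_integrable_powr_cong_AE[OF slice_lp_norm_cong_AE[OF assms]]
    by (simp add: lp_norm_nonneg)
  show ?thesis
    unfolding lq_lp_mem_def borel_measurable_lebesgue_cong_AE[OF assms] 1 2 3 ..
qed

lemma riesz_cong_AE: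
  assumes "AE y in lebesgue. f y = g y"
  shows "riesz j f = riesz j g"
proof
  fix x
  have "(LINT y:{y. \<epsilon> \<le> norm (x - y)}|lebesgue. (x - y) $ j / norm (x - y) ^ 4 * f y) =
        (LINT y:{y. \<epsilon> \<le> norm (x - y)}|lebesgue. (x - y) $ j / norm (x - y) ^ 4 * g y)" for \<epsilon>
    unfolding set_lebesgue_integral_def
    by (rule integral_lebesgue_cong_AE, use assms in \<open>rule eventually_mono\<close>) auto
  then show "riesz j f x = riesz j g x"
    by (simp add: riesz_def)
qed

lemma riesz_riesz_cong_AE:
  assumes "AE z in lebesgue. F z = G z"
  shows "AE z in lebesgue. riesz_riesz F z = riesz_riesz G z"
proof -
  have "AE t in lebesgue. \<forall>x. riesz_riesz F (t, x) = riesz_riesz G (t, x)"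
    using AE_lebesgue_slice[OF assms]
  proof (rule eventually_mono)
    fix t assume t: "AE x in lebesgue. F (t, x) = G (t, x)"
    have "riesz j (\<lambda>y. if y \<in> ball 0 1 then F (t, y) $ i $ j else 0) =
          riesz j (\<lambda>y. if y \<in> ball 0 1 then G (t, y) $ i $ j else 0)" for i j
      by (rule riesz_cong_AE, use t in \<open>rule eventually_mono\<close>) auto
    then show "\<forall>x. riesz_riesz F (t, x) = riesz_riesz G (t, x)"
      by (simp add: riesz_riesz_def)
  qed
  from AE_lebesgue_cylinder[OF this] show ?thesis
    by (rule eventually_mono) (metis prod.collapse)
qed

text \<open>An element of a Lebesgue space over a subset of $\mathbf{R} \times \mathbf{R}^3$ is represented
  by the class of its zero extension, so that equality in the Lebesgue space is equality in this
  type.\<close>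

quotient_type 'b stfun = "real \<times> (real^3) \<Rightarrow> 'b" /
  "\<lambda>f g. AE z in lebesgue. f z = g z"
proof (rule equivpI)
  show "reflp (\<lambda>f g :: real \<times> (real^3) \<Rightarrow> 'b. AE z in lebesgue. f z = g z)"
    by (auto intro: reflpI)
  show "symp (\<lambda>f g :: real \<times> (real^3) \<Rightarrow> 'b. AE z in lebesgue. f z = g z)"
    by (auto intro!: sympI elim: eventually_mono)
  show "transp (\<lambda>f g :: real \<times> (real^3) \<Rightarrow> 'b. AE z in lebesgue. f z = g z)"
    by (rule transpI) (auto elim: eventually_elim2)
qed

instantiation stfun :: (real_vector) real_vector
begin

lift_definition zero_stfun :: "'a stfun" is "\<lambda>_. 0" .
lift_definition plus_stfun :: "'a stfun \<Rightarrow> 'a stfun \<Rightarrow> 'a stfun" is "\<lambda>f g z. f z + g z"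
  by (auto elim: eventually_elim2)
lift_definition minus_stfun :: "'a stfun \<Rightarrow> 'a stfun \<Rightarrow> 'a stfun" is "\<lambda>f g z. f z - g z"
  by (auto elim: eventually_elim2)
lift_definition uminus_stfun :: "'a stfun \<Rightarrow> 'a stfun" is "\<lambda>f z. - f z"
  by (auto elim: eventually_mono)
lift_definition scaleR_stfun :: "real \<Rightarrow> 'a stfun \<Rightarrow> 'a stfun" is "\<lambda>c f z. c *\<^sub>R f z"
  by (auto elim: eventually_mono)

instance
  by standard (transfer, simp add: algebra_simps)+

end

lift_definition Lp_norm :: "real \<Rightarrow> (real \<times> (real^3)) set \<Rightarrow> 'b::euclidean_space stfun \<Rightarrow> real"
  is lp_norm by (rule lp_norm_cong_AE)

lift_definition Lp_mem :: "real \<Rightarrow> (real \<times> (real^3)) set \<Rightarrow> 'b::euclidean_space stfun \<Rightarrow> bool"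
  is lp_mem by (rule lp_mem_cong_AE)

lift_definition LqLp_norm ::
  "real \<Rightarrow> real \<Rightarrow> real set \<Rightarrow> (real^3) set \<Rightarrow> 'b::euclidean_space stfun \<Rightarrow> real"
  is lq_lp_norm by (rule lq_lp_norm_cong_AE)

lift_definition LqLp_mem ::
  "real \<Rightarrow> real \<Rightarrow> real set \<Rightarrow> (real^3) set \<Rightarrow> 'b::euclidean_space stfun \<Rightarrow> bool"
  is lq_lp_mem by (rule lq_lp_mem_cong_AE)

lift_definition RiRj :: "(real^3^3) stfun \<Rightarrow> real stfun"
  is riesz_riesz by (rule riesz_riesz_cong_AE)

lift_definition cutoff_tensor :: "(real^3 \<Rightarrow> real) \<Rightarrow> (real^3) stfun \<Rightarrow> (real^3^3) stfun"
  is "\<lambda>\<eta> u (t, x). \<chi> i j. \<eta> x * u (t, x) $ i * u (t, x) $ j"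
  by (auto elim: eventually_mono)

lift_definition spatially_harmonic :: "real set \<Rightarrow> (real^3) set \<Rightarrow> real stfun \<Rightarrow> bool"
  is "\<lambda>T B f. AE t in lebesgue. t \<in> T \<longrightarrow>
        (\<exists>h. harmonic_on B h \<and> (AE x in lebesgue. x \<in> B \<longrightarrow> f (t, x) = h x))"
proof -
  fix T :: "real set" and B and f g :: "real \<times> (real^3) \<Rightarrow> real"
  assume "AE z in lebesgue. f z = g z"
  from AE_lebesgue_slice[OF this]
  show "(AE t in lebesgue. t \<in> T \<longrightarrow>
        (\<exists>h. harmonic_on B h \<and> (AE x in lebesgue. x \<in> B \<longrightarrow> f (t, x) = h x))) =
     (AE t in lebesgue. t \<in> T \<longrightarrow>
        (\<exists>h. harmonic_on B h \<and> (AE x in lebesgue. x \<in> B \<longrightarrow> g (t, x) = h x)))"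
  proof (intro AE_imp_cong, elim eventually_mono)
    fix t assume t: "AE x in lebesgue. f (t, x) = g (t, x)"
    have "(AE x in lebesgue. x \<in> B \<longrightarrow> f (t, x) = h x) =
          (AE x in lebesgue. x \<in> B \<longrightarrow> g (t, x) = h x)" for h
      by (rule AE_imp_cong, use t in \<open>rule eventually_mono\<close>) auto
    then show "(t \<in> T \<longrightarrow>
        (\<exists>h. harmonic_on B h \<and> (AE x in lebesgue. x \<in> B \<longrightarrow> f (t, x) = h x))) =
     (t \<in> T \<longrightarrow>
        (\<exists>h. harmonic_on B h \<and> (AE x in lebesgue. x \<in> B \<longrightarrow> g (t, x) = h x)))"
      by simp
  qed
qed


section \<open>The spaces of the localized problem\<close>

abbreviation I_time :: "real set" where
  "I_time \<equiv> {-1<..<0}"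

abbreviation Q1 :: "(real \<times> (real^3)) set" where
  "Q1 \<equiv> I_time \<times> ball 0 1"

definition X_src :: "(real^3^3) stfun set" where
  "X_src = {E. LqLp_mem (3/2) (3/2) I_time (ball 0 1) E}"

definition Y_harm :: "real stfun set" where
  "Y_harm = {p. LqLp_mem (3/2) (3/2) I_time (ball 0 (3/4)) p}"

definition harmonic_pressures :: "real stfun set" where
  "harmonic_pressures = {p \<in> Y_harm. spatially_harmonic I_time (ball 0 (3/4)) p}"

definition L3_vel :: "(real^3) stfun set" where
  "L3_vel = {u. Lp_mem 3 Q1 u}"

text \<open>Matrices carry the Euclidean (Frobenius) norm.\<close>

definition norm_L3 :: "(real^3) stfun \<Rightarrow> real" where
  "norm_L3 u = Lp_norm 3 Q1 u"

definition norm_X_src :: "(real^3^3) stfun \<Rightarrow> real" where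
  "norm_X_src E = LqLp_norm (3/2) (3/2) I_time (ball 0 1) E"

definition norm_Y_prs :: "real stfun \<Rightarrow> real" where
  "norm_Y_prs p = LqLp_norm (3/2) (3/2) I_time (ball 0 (1/2)) p"

definition norm_Y_harm :: "real stfun \<Rightarrow> real" where
  "norm_Y_harm p = LqLp_norm (3/2) (3/2) I_time (ball 0 (3/4)) p"


section \<open>Packages\<close>

text \<open>A point of the product of all coordinate spaces, in the order
  $(u, p_{act}, p_{harm}, F^{cl}, E^{cl}_F, \Pi, \Phi, T, s)$. The product is a real vector space; the
  four auxiliary data are taken from arbitrary real vector spaces.\<close>

type_synonym ('f, 'e, 't, 's) pkg =
  "(real^3) stfun \<times> real stfun \<times> real stfun \<times> (real^3^3) stfun \<times> (real^3^3) stfun \<times> 'f \<times> 'e \<times> 't \<times> 's"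

definition vel :: "('f, 'e, 't, 's) pkg \<Rightarrow> (real^3) stfun" where
  "vel = (\<lambda>(u, pa, ph, F, E, f, e, t, s). u)"

definition p_act :: "('f, 'e, 't, 's) pkg \<Rightarrow> real stfun" where
  "p_act = (\<lambda>(u, pa, ph, F, E, f, e, t, s). pa)"

definition p_harm :: "('f, 'e, 't, 's) pkg \<Rightarrow> real stfun" where
  "p_harm = (\<lambda>(u, pa, ph, F, E, f, e, t, s). ph)"

definition F_cl :: "('f, 'e, 't, 's) pkg \<Rightarrow> (real^3^3) stfun" where
  "F_cl = (\<lambda>(u, pa, ph, F, E, f, e, t, s). F)"

definition E_cl :: "('f, 'e, 't, 's) pkg \<Rightarrow> (real^3^3) stfun" where
  "E_cl = (\<lambda>(u, pa, ph, F, E, f, e, t, s). E)"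

definition aux :: "('f, 'e, 't, 's) pkg \<Rightarrow> real stfun \<times> 'f \<times> 'e \<times> 't \<times> 's" where
  "aux = (\<lambda>(u, pa, ph, F, E, f, e, t, s). (pa, f, e, t, s))"

definition split_package :: "(real^3 \<Rightarrow> real) \<Rightarrow> ('f, 'e, 't, 's) pkg \<Rightarrow> bool" where
  "split_package \<eta> D \<longleftrightarrow>
     vel D \<in> L3_vel \<and> E_cl D \<in> X_src \<and> p_harm D \<in> harmonic_pressures \<and>
     F_cl D = cutoff_tensor \<eta> (vel D) + E_cl D"

text \<open>The linear space in which packages live: the quadratic constraint on $F^{cl}$ is dropped.\<close>

definition package_coordinates :: "('f, 'e, 't, 's) pkg set" where
  "package_coordinates =
     {D. vel D \<in> L3_vel \<and> E_cl D \<in> X_src \<and> F_cl D \<in> X_src \<and> p_harm D \<in> harmonic_pressures}"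

definition finite_dim_subspace :: "'a::real_vector set \<Rightarrow> bool" where
  "finite_dim_subspace S \<longleftrightarrow> (\<exists>B. finite B \<and> span B = S)"

text \<open>The gauge class $\{0\} \times G_E \times G_h \times G_{aux}$ embedded in the product of the
  coordinate spaces. The coordinate $F^{cl}$ of a gauge is its $E$-coordinate, so that
  the vector space difference \<open>D - \<zeta>\<close> is the shifted package, whose source
  $F^{cl}$ is $\eta u_i u_j + (E - \zeta_E)_{ij}$; see \<open>split_package_shift\<close> below.\<close>

definition gauge_class ::
  "(real^3^3) stfun set \<Rightarrow> real stfun set \<Rightarrow>
   (real stfun \<times> 'f::real_vector \<times> 'e::real_vector \<times> 't::real_vector \<times> 's::real_vector) set \<Rightarrow>
   ('f, 'e, 't, 's) pkg set" where
  "gauge_class G_E G_h G_aux =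
     {\<zeta>. vel \<zeta> = 0 \<and> E_cl \<zeta> \<in> G_E \<and> F_cl \<zeta> = E_cl \<zeta> \<and> p_harm \<zeta> \<in> G_h \<and> aux \<zeta> \<in> G_aux}"

definition conservative_gauge_class ::
  "('f::real_vector, 'e::real_vector, 't::real_vector, 's::real_vector) pkg set \<Rightarrow> bool" where
  "conservative_gauge_class \<Gamma> \<longleftrightarrow>
     (\<exists>G_E G_h G_aux. \<Gamma> = gauge_class G_E G_h G_aux \<and>
        finite_dim_subspace G_E \<and> G_E \<subseteq> X_src \<and>
        finite_dim_subspace G_h \<and> G_h \<subseteq> harmonic_pressures \<and>
        finite_dim_subspace G_aux)"

lemma pkg_minus_simps:
  fixes D \<zeta> :: "('f::real_vector, 'e::real_vector, 't::real_vector, 's::real_vector) pkg"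
  shows "vel (D - \<zeta>) = vel D - vel \<zeta>" "p_act (D - \<zeta>) = p_act D - p_act \<zeta>"
    "p_harm (D - \<zeta>) = p_harm D - p_harm \<zeta>" "F_cl (D - \<zeta>) = F_cl D - F_cl \<zeta>"
    "E_cl (D - \<zeta>) = E_cl D - E_cl \<zeta>" "aux (D - \<zeta>) = aux D - aux \<zeta>"
  by (cases D; cases \<zeta>; simp add: vel_def p_act_def p_harm_def F_cl_def E_cl_def aux_def)+

lemma split_package_shift:
  assumes "split_package \<eta> D" "\<zeta> \<in> gauge_class G_E G_h G_aux"
  shows "vel (D - \<zeta>) = vel D"
    and "F_cl (D - \<zeta>) = cutoff_tensor \<eta> (vel D) + E_cl (D - \<zeta>)"
  using assms by (auto simp: pkg_minus_simps split_package_def gauge_class_def)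


section \<open>Norms and distances\<close>

definition norm_on :: "'a::real_vector set \<Rightarrow> ('a \<Rightarrow> real) \<Rightarrow> bool" where
  "norm_on X N \<longleftrightarrow>
     (\<forall>x\<in>X. 0 \<le> N x \<and> (N x = 0 \<longleftrightarrow> x = 0)) \<and>
     (\<forall>x\<in>X. \<forall>y\<in>X. N (x + y) \<le> N x + N y) \<and>
     (\<forall>c. \<forall>x\<in>X. N (c *\<^sub>R x) = \<bar>c\<bar> * N x)"

definition tail_norm ::
  "(('f, 'e, 't, 's) pkg \<Rightarrow> real) \<Rightarrow> ('f, 'e, 't, 's) pkg \<Rightarrow> real" where
  "tail_norm N0 D = N0 D + norm_Y_prs (RiRj (F_cl D)) + norm_Y_harm (p_harm D)"

definition gauge_dist :: "('a::real_vector \<Rightarrow> real) \<Rightarrow> 'a \<Rightarrow> 'a set \<Rightarrow> real" where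
  "gauge_dist N D \<Gamma> = (INF \<zeta>\<in>\<Gamma>. N (D - \<zeta>))"

definition tail_dist ::
  "(('f::real_vector, 'e::real_vector, 't::real_vector, 's::real_vector) pkg \<Rightarrow> real) \<Rightarrow>
   (('f, 'e, 't, 's) pkg \<Rightarrow> ('f, 'e, 't, 's) pkg \<Rightarrow> real) \<Rightarrow>
   (('f, 'e, 't, 's) pkg \<Rightarrow> ('f, 'e, 't, 's) pkg \<Rightarrow> real) \<Rightarrow>
   real \<Rightarrow> real \<Rightarrow> ('f, 'e, 't, 's) pkg \<Rightarrow> ('f, 'e, 't, 's) pkg set \<Rightarrow> real" where
  "tail_dist N0 T_proj T_harm \<alpha>_proj \<alpha>_harm D \<Gamma> =
     (INF \<zeta>\<in>\<Gamma>. tail_norm N0 (D - \<zeta>) + \<alpha>_proj * T_proj D \<zeta> + \<alpha>_harm * T_harm D \<zeta>)"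

text \<open>The finite-dimensional normed package space of a tail-compatible class; the bounds on the
  tail functionals are not part of it.\<close>

definition finite_window_space ::
  "(('f::real_vector, 'e::real_vector, 't::real_vector, 's::real_vector) pkg \<Rightarrow> real) \<Rightarrow>
   ('f, 'e, 't, 's) pkg set \<Rightarrow> ('f, 'e, 't, 's) pkg set \<Rightarrow> ('f, 'e, 't, 's) pkg set \<Rightarrow> bool" where
  "finite_window_space N0 X C \<Gamma> \<longleftrightarrow>
     finite_dim_subspace X \<and> X \<subseteq> package_coordinates \<and>
     norm_on X (tail_norm N0) \<and>
     C \<subseteq> X \<and> \<Gamma> \<subseteq> X \<and> subspace \<Gamma>"

end

theory Submission
  imports Defs
begin

text \<open>An infimum is at most its value at any single gauge, so \<open>tail_dist\<close> is
  tested at the baseline near-minimizer \<open>\<zeta>0\<close> (\<open>tail_dist_le\<close>). There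
  the tail bounds make the whole expression at most \<open>C_tail\<close> times the tail norm of
  \<open>D - \<zeta>0\<close>, plus the weighted errors. That tail norm exceeds the baseline norm by
  the active-pressure and harmonic terms. Calderon-Zygmund controls the former by a quantity
  quadratic in the velocity; the amplitude bound \<open>M_U\<close> makes it linear
  (\<open>quadratic_plus_linear_le\<close>), and visibility then bounds everything by the baseline
  distance (\<open>tail_norm_near_minimizer_le\<close>). Using one and the same gauge throughout is
  what lets these estimates be chained.\<close>

lemma Lp_norm_nonneg: "0 \<le> Lp_norm p S f"
  by transfer (rule lp_norm_nonneg)

lemma LqLp_norm_nonneg: "0 \<le> LqLp_norm q p T B f"
  by transfer (simp add: lq_lp_norm_def lp_norm_nonneg)

lemma subspace_finite_dim_subspace: "finite_dim_subspace S \<Longrightarrow> subspace S"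
  by (auto simp: finite_dim_subspace_def)

text \<open>One factor \<open>u\<close> of the square is traded for its bound \<open>M\<close>. Each
  entry of the maximum then serves one summand: \<open>C * M\<close> for \<open>u\<close>,
  \<open>C\<close> for \<open>e\<close>, and 1 for \<open>h\<close>.\<close>

lemma quadratic_plus_linear_le:
  fixes C M u e h :: real
  assumes "0 \<le> u" "u \<le> M" "0 \<le> e" "0 \<le> h"
  shows "C * (u\<^sup>2 + e) + h \<le> Max {C * M, C, 1} * (u + e + h)"
proof -
  define m where "m = Max {C * M, C, 1}"
  have m: "C * M \<le> m" "C \<le> m" "1 \<le> m"
    by (auto simp: m_def)
  \<comment> \<open>The sign of \<open>C\<close> is left open. For negative \<open>C\<close> the
    inequality \<open>u \<le> M\<close> would reverse under multiplication, but then
    \<open>C * u\<close> is at most 0 and the entry 1 of the maximum suffices.\<close>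
  have "C * u \<le> m"
  proof (cases "0 \<le> C")
    case True
    then have "C * u \<le> C * M"
      using assms(2) by (rule mult_left_mono[rotated])
    then show ?thesis
      using m(1) by linarith
  next
    case False
    then have "C * u \<le> 0"
      using assms(1) by (simp add: mult_nonpos_nonneg)
    then show ?thesis
      using m(3) by linarith
  qed
  then have "C * u * u \<le> m * u"
    using assms(1) by (rule mult_right_mono)
  moreover have "C * e \<le> m * e" "1 * h \<le> m * h"
    using m assms by (intro mult_right_mono; simp)+
  ultimately show ?thesis
    unfolding m_def[symmetric] by (simp add: power2_eq_square algebra_simps)
qed

text \<open>Here \<open>D\<close> stands for the already shifted package and \<open>d\<close> for
  the baseline distance of the original one. The two terms added to the baseline norm are bounded by
  the three coordinates that visibility controls.\<close>

lemma tail_norm_near_minimizer_le: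
  assumes "N D \<le> d + \<delta>"
    and "norm_Y_prs (RiRj (F_cl D)) \<le> C_CZ * ((norm_L3 (vel D))\<^sup>2 + norm_X_src (E_cl D))"
    and "norm_L3 (vel D) + norm_X_src (E_cl D) + norm_Y_harm (p_harm D) \<le> C_vis * d + \<Delta>"
    and "norm_L3 (vel D) \<le> M"
  shows "tail_norm N D \<le>
    (1 + C_vis * Max {C_CZ * M, C_CZ, 1}) * d + \<delta> + Max {C_CZ * M, C_CZ, 1} * \<Delta>"
proof -
  define m where "m = Max {C_CZ * M, C_CZ, 1}"
  let ?u = "norm_L3 (vel D)" and ?e = "norm_X_src (E_cl D)" and ?h = "norm_Y_harm (p_harm D)"
  have "0 \<le> m"
    by (rule order_trans[of _ 1]) (auto simp: m_def)
  have "C_CZ * (?u\<^sup>2 + ?e) + ?h \<le> m * (?u + ?e + ?h)"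
    unfolding m_def using assms(4)
    by (intro quadratic_plus_linear_le)
      (simp_all add: norm_L3_def norm_X_src_def norm_Y_harm_def Lp_norm_nonneg LqLp_norm_nonneg)
  \<comment> \<open>Visibility is used once, for the sum of the three coordinates; this is why a
    single maximum multiplies both \<open>C_vis\<close> and \<open>\<Delta>\<close>.\<close>
  also have "\<dots> \<le> m * (C_vis * d + \<Delta>)"
    using assms(3) \<open>0 \<le> m\<close> by (rule mult_left_mono)
  finally show ?thesis
    using assms(1,2) unfolding tail_norm_def m_def[symmetric] by (simp add: algebra_simps)
qed

text \<open>An infimum of reals lies below its members only if the set is bounded below; 0 is such a
  bound here, since every summand is nonnegative.\<close>

lemma tail_dist_le:
  assumes "finite_window_space N0 X C \<Gamma>" "D \<in> C" "\<zeta>0 \<in> \<Gamma>"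
    and "0 \<le> \<alpha>_proj" "0 \<le> \<alpha>_harm"
    and "\<And>\<zeta>. \<zeta> \<in> \<Gamma> \<Longrightarrow> 0 \<le> T_proj D \<zeta>" "\<And>\<zeta>. \<zeta> \<in> \<Gamma> \<Longrightarrow> 0 \<le> T_harm D \<zeta>"
  shows "tail_dist N0 T_proj T_harm \<alpha>_proj \<alpha>_harm D \<Gamma>
    \<le> tail_norm N0 (D - \<zeta>0) + \<alpha>_proj * T_proj D \<zeta>0 + \<alpha>_harm * T_harm D \<zeta>0"
  unfolding tail_dist_def
proof (rule cINF_lower[OF bdd_belowI2[where m = 0] assms(3)])
  fix \<zeta> assume \<zeta>: "\<zeta> \<in> \<Gamma>"
  \<comment> \<open>The tail norm is known to be nonnegative only on \<open>X\<close>, so the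
    shifted package must stay in that subspace.\<close>
  have "D - \<zeta> \<in> X"
    using assms(1,2) \<zeta>
    by (auto simp: finite_window_space_def intro: subspace_diff subspace_finite_dim_subspace)
  then have "0 \<le> tail_norm N0 (D - \<zeta>)"
    using assms(1) by (simp add: finite_window_space_def norm_on_def)
  then show "0 \<le> tail_norm N0 (D - \<zeta>) + \<alpha>_proj * T_proj D \<zeta> + \<alpha>_harm * T_harm D \<zeta>"
    using assms(4-7) \<zeta> by simp
qed

theorem theorem4p66:
  fixes \<eta> :: "real^3 \<Rightarrow> real"
    and \<C> X \<Gamma> :: "('f::real_vector, 'e::real_vector, 't::real_vector, 's::real_vector) pkg set"
    and D \<zeta>0 :: "('f, 'e, 't, 's) pkg"
    and N0 :: "('f, 'e, 't, 's) pkg \<Rightarrow> real"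
    and T_proj T_harm :: "('f, 'e, 't, 's) pkg \<Rightarrow> ('f, 'e, 't, 's) pkg \<Rightarrow> real"
    and \<alpha>_proj \<alpha>_harm \<delta>0 C_CZ C_vis \<Delta>_vis M_U :: real
    and Ct_proj Ct_harm \<Delta>_proj \<Delta>_harm :: real
  assumes cutoff: "cutoff \<eta>"
    and packages: "\<And>D'. D' \<in> \<C> \<Longrightarrow> split_package \<eta> D'"
    and gauge: "conservative_gauge_class \<Gamma>"
    and baseline_norm: "norm_on X N0"
    and weights: "0 < \<alpha>_proj" "0 < \<alpha>_harm"
    and tails_nonneg:
      "\<And>D' \<zeta>. D' \<in> \<C> \<Longrightarrow> \<zeta> \<in> \<Gamma> \<Longrightarrow> 0 \<le> T_proj D' \<zeta>"
      "\<And>D' \<zeta>. D' \<in> \<C> \<Longrightarrow> \<zeta> \<in> \<Gamma> \<Longrightarrow> 0 \<le> T_harm D' \<zeta>"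
    and calderon_zygmund:
      "\<And>D' \<zeta>. D' \<in> \<C> \<Longrightarrow> \<zeta> \<in> \<Gamma> \<Longrightarrow>
         norm_Y_prs (RiRj (F_cl (D' - \<zeta>)))
           \<le> C_CZ * ((norm_L3 (vel (D' - \<zeta>)))\<^sup>2 + norm_X_src (E_cl (D' - \<zeta>)))"
    and D: "D \<in> \<C>"
    and near_minimizer:
      "\<zeta>0 \<in> \<Gamma>" "N0 (D - \<zeta>0) \<le> gauge_dist N0 D \<Gamma> + \<delta>0"
    and visibility:
      "0 \<le> \<Delta>_vis"
      "norm_L3 (vel (D - \<zeta>0)) + norm_X_src (E_cl (D - \<zeta>0)) + norm_Y_harm (p_harm (D - \<zeta>0))
         \<le> C_vis * gauge_dist N0 D \<Gamma> + \<Delta>_vis"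
    and amplitude: "norm_L3 (vel (D - \<zeta>0)) \<le> M_U"
    and window: "finite_window_space N0 X \<C> \<Gamma>"
    and tail_constants: "0 \<le> Ct_proj" "0 \<le> Ct_harm" "0 \<le> \<Delta>_proj" "0 \<le> \<Delta>_harm"
    and tail_bounds:
      "\<And>D' \<zeta>. D' \<in> \<C> \<Longrightarrow> \<zeta> \<in> \<Gamma> \<Longrightarrow>
         T_proj D' \<zeta> \<le> Ct_proj * tail_norm N0 (D' - \<zeta>) + \<Delta>_proj"
      "\<And>D' \<zeta>. D' \<in> \<C> \<Longrightarrow> \<zeta> \<in> \<Gamma> \<Longrightarrow>
         T_harm D' \<zeta> \<le> Ct_harm * tail_norm N0 (D' - \<zeta>) + \<Delta>_harm"
  shows "let C_tail = 1 + \<alpha>_proj * Ct_proj + \<alpha>_harm * Ct_harm;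
             C_tail0 = C_vis * Max {C_CZ * M_U, C_CZ, 1};
             \<Delta>_tail0 = Max {C_CZ * M_U, C_CZ, 1} * \<Delta>_vis
         in tail_dist N0 T_proj T_harm \<alpha>_proj \<alpha>_harm D \<Gamma>
              \<le> C_tail * ((1 + C_tail0) * gauge_dist N0 D \<Gamma> + \<delta>0 + \<Delta>_tail0)
                + \<alpha>_proj * \<Delta>_proj + \<alpha>_harm * \<Delta>_harm"
proof -
  define C_tail where "C_tail = 1 + \<alpha>_proj * Ct_proj + \<alpha>_harm * Ct_harm"
  define m where "m = Max {C_CZ * M_U, C_CZ, 1}"
  let ?n = "tail_norm N0 (D - \<zeta>0)" and ?d = "gauge_dist N0 D \<Gamma>"
  have "0 \<le> C_tail"
    using weights tail_constants by (simp add: C_tail_def)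
  have "tail_dist N0 T_proj T_harm \<alpha>_proj \<alpha>_harm D \<Gamma>
      \<le> ?n + \<alpha>_proj * T_proj D \<zeta>0 + \<alpha>_harm * T_harm D \<zeta>0"
    using window D near_minimizer(1) weights tails_nonneg[OF D] by (intro tail_dist_le) auto
  also have "\<dots> \<le> ?n + \<alpha>_proj * (Ct_proj * ?n + \<Delta>_proj) + \<alpha>_harm * (Ct_harm * ?n + \<Delta>_harm)"
    using tail_bounds[OF D near_minimizer(1)] weights
    by (intro add_mono mult_left_mono) auto
  also have "\<dots> = C_tail * ?n + \<alpha>_proj * \<Delta>_proj + \<alpha>_harm * \<Delta>_harm"
    by (simp add: C_tail_def algebra_simps)
  \<comment> \<open>The tail norm at \<open>\<zeta>0\<close> is replaced by its baseline bound,
    which is monotone because \<open>C_tail\<close> is nonnegative.\<close>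
  also have "\<dots> \<le> C_tail * ((1 + C_vis * m) * ?d + \<delta>0 + m * \<Delta>_vis)
      + \<alpha>_proj * \<Delta>_proj + \<alpha>_harm * \<Delta>_harm"
    unfolding m_def
    using tail_norm_near_minimizer_le[where N = N0, OF near_minimizer(2)
        calderon_zygmund[OF D near_minimizer(1)] visibility(2) amplitude] \<open>0 \<le> C_tail\<close>
    by (intro add_right_mono mult_left_mono)
  finally show ?thesis
    by (simp only: Let_def C_tail_def m_def)
qed

end
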